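(* Let $s(x)=-x$ for $x\in\mathbb{R}^3$ and assume that $\sigma=s_\#\sigma$, where $s_\#\sigma$ is the image measure of $\sigma$ with respect to $s$. Let $\lambda\in\mathbb{R}\setminus\{0\}$ and let $H+V_\lambda$ be the Dirac operator coupled with the electrostatic shell potential $V_\lambda$ (defined in the context). If $H+V_\lambda$ has some eigenvalue $a\in(-m,m)$, then $H+V_{-\lambda}$ has $-a$ as an eigenvalue.
   Context: Fix $m>0$. Let $\sigma_1=\begin{pmatrix}0&1\\1&0\end{pmatrix}$, $\sigma_2=\begin{pmatrix}0&-i\\i&0\end{pmatrix}$, $\sigma_3=\begin{pmatrix}1&0\\0&-1\end{pmatrix}$, $\alpha_j=\begin{pmatrix}0&\sigma_j\\\sigma_j&0\end{pmatrix}$ ($j=1,2,3$), $\beta=\begin{pmatrix}I_2&0\\0&-I_2\end{pmatrix}$, $\alpha\cdot v=\sum_j v_j\alpha_j$, and let $H=-i\alpha\cdot\nabla+m\beta$ be the free Dirac operator in $\mathbb{R}^3$, acting in the sense of distributions. Let $\Omega_+\subset\mathbb{R}^3$ be a bounded domain with boundary $\Sigma$ of class $C^2$, $\Omega_-=\mathbb{R}^3\setminus\overline{\Omega_+}$, $\sigma$ the surface measure on $\Sigma$, and $\mu$ the Lebesgue measure on $\mathbb{R}^3$. Let $\mathcal{X}=\{G\mu+g\sigma: G\in L^2(\mu)^4,\ g\in L^2(\sigma)^4\}$ ($\mathbb{C}^4$-valued functions). Let $$\phi(x)=\frac{e^{-m|x|}}{4\pi|x|}\Big(m\beta+(1+m|x|)\,i\alpha\cdot\frac{x}{|x|^2}\Big),\quad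 x\in\mathbb{R}^3\setminus\{0\},$$ a fundamental solution of $H$. For $g\in L^2(\sigma)^4$ and $\sigma$-a.e. $x\in\Sigma$, $C_\sigma(g)(x)=\lim_{\epsilon\searrow0}\int_{|x-z|>\epsilon}\phi(x-z)g(z)\,d\sigma(z)$; this is a bounded operator on $L^2(\sigma)^4$. For $G\mu+g\sigma\in\mathcal{X}$ set $\Phi(G+g)=\phi*G\mu+\phi*g\sigma\in L^2(\mu)^4$, where $(\phi*f\nu)(x)=\int\phi(x-y)f(y)\,d\nu(y)$; then $H\Phi(G+g)=G\mu+g\sigma$ in distributions. Let $\Phi_\sigma(G)\in L^2(\sigma)^4$ be the trace on $\Sigma$ of $\Phi(G)=\phi*G\mu\in W^{1,2}(\mu)^4$, and let $C_\pm(g)(x)$ be the non-tangential limit at $x\in\Sigma$ of $\Phi(g)=\phi*g\sigma$ from $\Omega_\pm$ (bounded operators on $L^2(\sigma)^4$). For $\lambda\in\mathbb{R}\setminus\{0\}$, $T=H+V_\lambda$ is the operator in $L^2(\mu)^4$ with domain $D(T)=\{\Phi(G+g):G\mu+g\sigma\in\mathcal{X},\ \Phi_\sigma(G)=\Lambda(g)\}$, $\Lambda=-(1/\lambda+C_\sigma)$, where $V_\lambda(\varphi)=\frac{\lambda}{2}(\varphi_++\varphi_-)\sigma$ and $\varphi_\pm=\Phi_\sigma(G)+C_\pm(g)$ for $\varphi=\Phi(G+g)\in D(T)$. On $D(T)$ one has $V_\lambda(\varphi)=-g\sigma$, so $T(\Phi(G+g))=G$. A number $a$ is an eigenvalue of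 $T$ if $T\varphi=a\varphi$ for some $0\neq\varphi\in D(T)$. *)

theory Defs
  imports "HOL-Analysis.Analysis"
begin

type_synonym R3 = "real^3"
type_synonym C4 = "complex^4"

section \<open>Dirac matrices and the fundamental solution\<close>

definition pauli :: "3 \<Rightarrow> complex^2^2" where
  "pauli j =
     (if j = 1 then vector [vector [0, 1], vector [1, 0]]
      else if j = 2 then vector [vector [0, -\<i>], vector [\<i>, 0]]
      else vector [vector [1, 0], vector [0, -1]])"

definition block4 ::
  "complex^2^2 \<Rightarrow> complex^2^2 \<Rightarrow> complex^2^2 \<Rightarrow> complex^2^2 \<Rightarrow> complex^4^4" where
  "block4 A B C D = vector
     [vector [A$1$1, A$1$2, B$1$1, B$1$2],
      vector [A$2$1, A$2$2, B$2$1, B$2$2],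
      vector [C$1$1, C$1$2, D$1$1, D$1$2],
      vector [C$2$1, C$2$2, D$2$1, D$2$2]]"

definition dirac_alpha :: "3 \<Rightarrow> complex^4^4" where
  "dirac_alpha j = block4 0 (pauli j) (pauli j) 0"

definition dirac_beta :: "complex^4^4" where
  "dirac_beta = block4 (mat 1) 0 0 (- mat 1)"

definition alpha_dot :: "R3 \<Rightarrow> complex^4^4" where
  "alpha_dot v = (\<Sum>j\<in>UNIV. (v $ j) *\<^sub>R dirac_alpha j)"

definition phi :: "real \<Rightarrow> R3 \<Rightarrow> complex^4^4" where
  "phi m x = (exp (- m * norm x) / (4 * pi * norm x)) *\<^sub>R
     (m *\<^sub>R dirac_beta + (1 + m * norm x) *\<^sub>R (mat \<i> ** alpha_dot (x /\<^sub>R (norm x)\<^sup>2)))"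

section \<open>Domains of class C2 and surface measure\<close>

text \<open>\<open>Ck k f S\<close>: \<open>f\<close> is \<open>k\<close> times continuously differentiable on the open set \<open>S\<close>.\<close>

primrec Ck :: "nat \<Rightarrow> ('a::euclidean_space \<Rightarrow> 'b::real_normed_vector) \<Rightarrow> 'a set \<Rightarrow> bool" where
  "Ck 0 f S = continuous_on S f"
| "Ck (Suc k) f S = ((\<forall>x\<in>S. f differentiable (at x)) \<and>
     (\<forall>v\<in>Basis. Ck k (\<lambda>x. frechet_derivative f (at x) v) S))"

text \<open>Near each boundary point, after an orthogonal change of coordinates, the set is the part
  of a ball lying below the graph of a C2 function.\<close>

definition C2_boundary :: "R3 set \<Rightarrow> bool" where
  "C2_boundary \<Omega> \<longleftrightarrow> (\<forall>p\<in>frontier \<Omega>. \<exists>r>0. \<exists>(Q :: R3 \<Rightarrow> R3) (\<gamma> :: real \<times> real \<Rightarrow> real).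
     orthogonal_transformation Q \<and> Ck 2 \<gamma> UNIV \<and>
     \<Omega> \<inter> ball p r = {x \<in> ball p r. Q x $ 3 < \<gamma> (Q x $ 1, Q x $ 2)})"

definition bounded_C2_domain :: "R3 set \<Rightarrow> bool" where
  "bounded_C2_domain \<Omega> \<longleftrightarrow>
     open \<Omega> \<and> connected \<Omega> \<and> \<Omega> \<noteq> {} \<and> bounded \<Omega> \<and> C2_boundary \<Omega>"

text \<open>The surface measure is the two-dimensional Hausdorff measure restricted to the surface. The
  factor \<open>pi / 4\<close> normalises it to agree with Lebesgue measure on planes. Covering sets are
  required to be bounded because \<^const>\<open>diameter\<close> is meaningful only for bounded sets.\<close>

definition hausdorff2_pre :: "real \<Rightarrow> R3 set \<Rightarrow> ennreal" where
  "hausdorff2_pre \<delta> A =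
     (INF U \<in> {U :: nat \<Rightarrow> R3 set. A \<subseteq> (\<Union>i. U i) \<and> (\<forall>i. bounded (U i) \<and> diameter (U i) \<le> \<delta>)}.
        \<Sum>i. ennreal (pi / 4 * (diameter (U i))\<^sup>2))"

definition hausdorff2 :: "R3 set \<Rightarrow> ennreal" where
  "hausdorff2 A = (SUP \<delta> \<in> {0<..}. hausdorff2_pre \<delta> A)"

definition surface_measure :: "R3 set \<Rightarrow> R3 measure" where
  "surface_measure S = measure_of UNIV (sets borel) (\<lambda>A. hausdorff2 (A \<inter> S))"

section \<open>L2 functions, distributions, traces\<close>

definition L2 :: "R3 measure \<Rightarrow> (R3 \<Rightarrow> C4) set" where
  "L2 \<nu> = {f. f \<in> borel_measurable \<nu> \<and> integrable \<nu> (\<lambda>x. (norm (f x))\<^sup>2)}"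

definition L2_converges :: "R3 measure \<Rightarrow> (nat \<Rightarrow> R3 \<Rightarrow> C4) \<Rightarrow> (R3 \<Rightarrow> C4) \<Rightarrow> bool" where
  "L2_converges \<nu> w f \<longleftrightarrow>
     (\<lambda>n. \<integral>\<^sup>+ x. ennreal ((norm (w n x - f x))\<^sup>2) \<partial>\<nu>) \<longlonglongrightarrow> 0"

definition test_function :: "(R3 \<Rightarrow> 'b::real_normed_vector) \<Rightarrow> bool" where
  "test_function \<theta> \<longleftrightarrow> (\<forall>k. Ck k \<theta> UNIV) \<and> compact (closure {x. \<theta> x \<noteq> 0})"

definition pderiv3 :: "3 \<Rightarrow> (R3 \<Rightarrow> 'b::real_normed_vector) \<Rightarrow> R3 \<Rightarrow> 'b" where
  "pderiv3 j \<theta> x = frechet_derivative \<theta> (at x) (axis j 1)"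

text \<open>A \<open>C4\<close>-valued distribution is given by its values on scalar test functions; only these
  values are ever compared.\<close>

type_synonym distribution = "(R3 \<Rightarrow> complex) \<Rightarrow> C4"

text \<open>\<open>dist_of \<nu> f\<close> is the distribution \<open>f \<nu>\<close>.\<close>

definition dist_of :: "R3 measure \<Rightarrow> (R3 \<Rightarrow> C4) \<Rightarrow> distribution" where
  "dist_of \<nu> f = (\<lambda>\<theta>. \<integral>x. \<theta> x *s f x \<partial>\<nu>)"

definition dist_pderiv :: "3 \<Rightarrow> distribution \<Rightarrow> distribution" where
  "dist_pderiv j D = (\<lambda>\<theta>. - D (pderiv3 j \<theta>))"

definition dist_H :: "real \<Rightarrow> distribution \<Rightarrow> distribution" where
  "dist_H m D = (\<lambda>\<theta>. (- \<i>) *s (\<Sum>j\<in>UNIV. dirac_alpha j *v dist_pderiv j D \<theta>)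
                      + m *\<^sub>R (dirac_beta *v D \<theta>))"

text \<open>\<open>is_trace S u t\<close>: \<open>u\<close> lies in \<open>W\<^sup>1\<^sup>,\<^sup>2\<close> of the whole space and \<open>t\<close> is its trace on \<open>S\<close>, the trace
  operator being the continuous extension of restriction from smooth compactly supported
  functions.\<close>

definition is_trace :: "R3 set \<Rightarrow> (R3 \<Rightarrow> C4) \<Rightarrow> (R3 \<Rightarrow> C4) \<Rightarrow> bool" where
  "is_trace S u t \<longleftrightarrow> u \<in> L2 lborel \<and> t \<in> L2 (surface_measure S) \<and>
     (\<exists>D. (\<forall>j. D j \<in> L2 lborel \<and>
             (\<forall>\<theta>. test_function \<theta> \<longrightarrow>
                dist_pderiv j (dist_of lborel u) \<theta> = dist_of lborel (D j) \<theta>)) \<and>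
          (\<exists>w. (\<forall>n. test_function (w n)) \<and> L2_converges lborel w u \<and>
               (\<forall>j. L2_converges lborel (\<lambda>n. pderiv3 j (w n)) (D j)) \<and>
               L2_converges (surface_measure S) w t))"

section \<open>Potentials and boundary operators\<close>

definition conv_phi :: "real \<Rightarrow> R3 measure \<Rightarrow> (R3 \<Rightarrow> C4) \<Rightarrow> R3 \<Rightarrow> C4" where
  "conv_phi m \<nu> f x = (\<integral>y. phi m (x - y) *v f y \<partial>\<nu>)"

text \<open>The operators below are given by their graphs on almost-everywhere classes:
  \<open>is_C_sigma m S g c\<close> says that \<open>c\<close> represents \<open>C\<^sub>\<sigma> g\<close>, and \<open>is_C_side m S W g c\<close> that \<open>c\<close>
  represents the non-tangential boundary values on \<open>S\<close>, from the side \<open>W\<close>, of the potential of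
  \<open>g\<close>. The limits exist only almost everywhere, so no value is chosen at the exceptional points.\<close>

definition is_C_sigma :: "real \<Rightarrow> R3 set \<Rightarrow> (R3 \<Rightarrow> C4) \<Rightarrow> (R3 \<Rightarrow> C4) \<Rightarrow> bool" where
  "is_C_sigma m S g c \<longleftrightarrow> c \<in> L2 (surface_measure S) \<and>
     (AE x in surface_measure S. x \<in> S \<longrightarrow>
        ((\<lambda>\<epsilon>. LINT z:{z. norm (x - z) > \<epsilon>}|surface_measure S. phi m (x - z) *v g z)
           \<longlongrightarrow> c x) (at_right 0))"

definition nontangential_region :: "R3 set \<Rightarrow> R3 set \<Rightarrow> real \<Rightarrow> R3 \<Rightarrow> R3 set" where
  "nontangential_region S W b x = {y \<in> W. norm (y - x) < (1 + b) * infdist y S}"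

definition is_C_side :: "real \<Rightarrow> R3 set \<Rightarrow> R3 set \<Rightarrow> (R3 \<Rightarrow> C4) \<Rightarrow> (R3 \<Rightarrow> C4) \<Rightarrow> bool" where
  "is_C_side m S W g c \<longleftrightarrow> c \<in> L2 (surface_measure S) \<and>
     (AE x in surface_measure S. x \<in> S \<longrightarrow> (\<forall>b>0.
        (conv_phi m (surface_measure S) g \<longlongrightarrow> c x) (at x within nontangential_region S W b x)))"

section \<open>The Dirac operator with electrostatic shell potential\<close>

text \<open>\<open>dirac_shell m lam \<Omega> \<phi> F\<close> is the graph of \<open>T = H + V\<close> in \<open>L2 lborel\<close>: \<open>\<phi>\<close> lies in
  the domain of \<open>T\<close> and \<open>T \<phi> = F\<close>. Here \<open>\<phi> = \<Phi>(G + g)\<close>; \<open>t\<close> is the trace of \<open>\<Phi>(G)\<close>; \<open>c\<close>, \<open>cp\<close>,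
  \<open>cm\<close> represent \<open>C\<^sub>\<sigma> g\<close>, \<open>C\<^sub>+ g\<close>, \<open>C\<^sub>- g\<close>. The identity \<open>T \<phi> = H \<phi> + V \<phi>\<close>, with
  \<open>V \<phi> = (lam / 2) (\<phi>\<^sub>+ + \<phi>\<^sub>-) \<sigma>\<close>, is understood in the sense of distributions.\<close>

definition dirac_shell ::
  "real \<Rightarrow> real \<Rightarrow> R3 set \<Rightarrow> (R3 \<Rightarrow> C4) \<Rightarrow> (R3 \<Rightarrow> C4) \<Rightarrow> bool" where
  "dirac_shell m lam \<Omega> \<phi> F \<longleftrightarrow>
     \<phi> \<in> L2 lborel \<and> F \<in> L2 lborel \<and>
     (let S = frontier \<Omega>; \<sigma> = surface_measure S in
      \<exists>G g t c cp cm.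
        G \<in> L2 lborel \<and> g \<in> L2 \<sigma> \<and>
        (AE x in lborel. \<phi> x = conv_phi m lborel G x + conv_phi m \<sigma> g x) \<and>
        is_trace S (conv_phi m lborel G) t \<and>
        is_C_sigma m S g c \<and>
        (AE x in \<sigma>. t x = - ((1 / lam) *\<^sub>R g x + c x)) \<and>
        is_C_side m S \<Omega> g cp \<and>
        is_C_side m S (- closure \<Omega>) g cm \<and>
        (\<forall>\<theta>. test_function \<theta> \<longrightarrow>
           dist_H m (dist_of lborel \<phi>) \<theta>
             + dist_of \<sigma> (\<lambda>x. (lam / 2) *\<^sub>R ((t x + cp x) + (t x + cm x))) \<theta>
           = dist_of lborel F \<theta>))"

definition is_eigenvalue :: "((R3 \<Rightarrow> C4) \<Rightarrow> (R3 \<Rightarrow> C4) \<Rightarrow> bool) \<Rightarrow> real \<Rightarrow> bool" where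
  "is_eigenvalue T a \<longleftrightarrow>
     (\<exists>\<phi>. \<not> (AE x in lborel. \<phi> x = 0) \<and> T \<phi> (\<lambda>x. a *\<^sub>R \<phi> x))"

end

theory Submission
  imports Defs
begin

text \<open>The proof is by charge conjugation. With \<open>U = i \<beta> \<alpha>\<^sub>2\<close>, the antilinear isometric involution
  \<open>J z = U (cnj z)\<close> satisfies \<open>\<alpha>\<^sub>j J = J \<alpha>\<^sub>j\<close> and \<open>\<beta> J = - J \<beta>\<close>. Being antilinear, it anticommutes
  with \<open>H\<close> and with the kernel \<open>phi\<close>, but commutes with multiplication by real potentials. Hence \<open>J\<close>
  maps an eigenfunction \<open>\<Phi>(G + g)\<close> of \<open>H + V\<^sub>\<lambda>\<close> for \<open>a\<close> to the eigenfunction \<open>\<Phi>(- J G - J g)\<close> of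
  \<open>H + V\<^sub>-\<^sub>\<lambda>\<close> for \<open>- a\<close>.\<close>

section \<open>The antilinear conjugation, the Dirac matrices and the kernel\<close>

definition charge_conj :: "C4 \<Rightarrow> C4" where
  "charge_conj z = vector [cnj (z$4), - cnj (z$3), - cnj (z$2), cnj (z$1)]"

lemma vector_4 [simp]:
  "(vector [x, y, z, w] :: 'a::zero^4) $ 1 = x" "(vector [x, y, z, w] :: 'a::zero^4) $ 2 = y"
  "(vector [x, y, z, w] :: 'a::zero^4) $ 3 = z" "(vector [x, y, z, w] :: 'a::zero^4) $ 4 = w"
  by (simp_all add: vector_def)

lemma charge_conj_nth [simp]:
  "charge_conj z $ 1 = cnj (z$4)" "charge_conj z $ 2 = - cnj (z$3)"
  "charge_conj z $ 3 = - cnj (z$2)" "charge_conj z $ 4 = cnj (z$1)"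
  by (simp_all add: charge_conj_def)

lemma charge_conj_involution [simp]: "charge_conj (charge_conj z) = z"
  by (simp add: vec_eq_iff forall_4)

lemma norm_charge_conj [simp]: "norm (charge_conj z) = norm z"
  by (simp add: norm_vec_def L2_set_def sum_4 add_ac)

text \<open>Complex antilinearity is real linearity, and \<open>bounded_linear\<close> is real; so
  linear and limit rules for real bounded operators all apply to \<open>charge_conj\<close>.\<close>

lemma bounded_linear_charge_conj: "bounded_linear charge_conj"
  by (rule bounded_linear_intro[where K = 1]) (simp_all add: vec_eq_iff forall_4)

lemmas linear_charge_conj = bounded_linear_charge_conj [THEN bounded_linear.linear]

lemmas charge_conj_zero [simp] = linear_0 [OF linear_charge_conj]
lemmas charge_conj_minus = linear_neg [OF linear_charge_conj]
lemmas charge_conj_add = linear_add [OF linear_charge_conj]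
lemmas charge_conj_diff = linear_diff [OF linear_charge_conj]
lemmas charge_conj_scaleR = linear_scale [OF linear_charge_conj]
lemmas charge_conj_sum = linear_sum [OF linear_charge_conj]
lemmas tendsto_charge_conj = bounded_linear.tendsto [OF bounded_linear_charge_conj]
lemmas continuous_on_charge_conj = bounded_linear.continuous_on [OF bounded_linear_charge_conj]

lemma charge_conj_eq_0_iff [simp]: "charge_conj z = 0 \<longleftrightarrow> z = 0"
  by (metis charge_conj_zero charge_conj_involution)

lemma charge_conj_scale: "charge_conj (c *s z) = cnj c *s charge_conj z"
  by (simp add: vec_eq_iff forall_4)

text \<open>\<open>U\<close> commutes with the real matrices \<open>\<alpha>\<^sub>1\<close>,
  \<open>\<alpha>\<^sub>3\<close> and anticommutes with \<open>\<alpha>\<^sub>2\<close>; the entries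
  of the latter are imaginary, so conjugating them supplies a second minus sign.\<close>

lemma dirac_alpha_charge_conj: "dirac_alpha j *v charge_conj z = charge_conj (dirac_alpha j *v z)"
  using exhaust_3[of j]
  by (auto simp: vec_eq_iff forall_4 matrix_vector_mult_def sum_4 dirac_alpha_def block4_def pauli_def)

lemma dirac_beta_charge_conj: "dirac_beta *v charge_conj z = - charge_conj (dirac_beta *v z)"
  by (simp add: vec_eq_iff forall_4 matrix_vector_mult_def sum_4 dirac_beta_def block4_def mat_def)

lemma scaleR_mult_vec: "(c *\<^sub>R A) *v z = c *\<^sub>R (A *v z)" for A :: "complex^'n^'k"
  by (simp add: vec_eq_iff matrix_vector_mult_def scaleR_sum_right)

lemma mat_mult_vec: "mat c *v z = c *s z" for z :: "complex^'n"
  by (simp add: vec_eq_iff matrix_vector_mult_def mat_def if_distrib[where f = "\<lambda>x. x * y" for y]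
      cong: if_cong)

lemma sum_mult_vec: "(\<Sum>j\<in>I. A j) *v z = (\<Sum>j\<in>I. A j *v z)" for A :: "'i \<Rightarrow> complex^'n^'k"
  by (induction I rule: infinite_finite_induct) (simp_all add: matrix_vector_mult_add_rdistrib)

lemma alpha_dot_charge_conj: "alpha_dot v *v charge_conj z = charge_conj (alpha_dot v *v z)"
  by (simp add: alpha_dot_def sum_mult_vec scaleR_mult_vec dirac_alpha_charge_conj
      charge_conj_sum charge_conj_scaleR)

text \<open>Both terms of the kernel change sign, for different reasons: the mass term because
  \<beta> anticommutes with the conjugation, the other because its factor \<open>\<i>\<close> is
  conjugated while \<alpha> commutes. The remaining coefficients are real.\<close>

lemma phi_charge_conj: "phi m x *v charge_conj z = - charge_conj (phi m x *v z)"
  by (simp add: phi_def scaleR_mult_vec matrix_vector_mult_add_rdistrib mat_mult_vec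
      matrix_vector_mul_assoc[symmetric] alpha_dot_charge_conj dirac_beta_charge_conj
      charge_conj_scale charge_conj_add charge_conj_scaleR scaleR_add_right)

text \<open>Negating the source absorbs the sign, so that potentials of conjugated densities are
  exactly conjugated potentials.\<close>

lemma phi_neg_charge_conj: "phi m x *v (- charge_conj z) = charge_conj (phi m x *v z)"
proof -
  have "A *v (- w) = - (A *v w)" for A :: "complex^4^4" and w
    using matrix_vector_mult_diff_distrib[of A 0 w] by simp
  then show ?thesis by (simp add: phi_charge_conj)
qed

text \<open>Since \<open>charge_conj\<close> is its own bounded inverse, integrability holds for
  both integrands or for neither; in the latter case both sides take the default value 0.\<close>

lemma integral_charge_conj: "(\<integral>x. charge_conj (f x) \<partial>\<nu>) = charge_conj (\<integral>x. f x \<partial>\<nu>)"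
  by (rule integral_bounded_linear'[OF bounded_linear_charge_conj bounded_linear_charge_conj]) simp

lemma conv_phi_charge_conj:
  "conv_phi m \<nu> (\<lambda>x. - charge_conj (f x)) x = charge_conj (conv_phi m \<nu> f x)"
  by (simp add: conv_phi_def phi_neg_charge_conj integral_charge_conj)

section \<open>Square-integrable functions and test functions\<close>

lemma L2_charge_conj:
  assumes "f \<in> L2 \<nu>" shows "(\<lambda>x. charge_conj (f x)) \<in> L2 \<nu>"
proof -
  have "charge_conj \<in> borel_measurable borel"
    by (intro borel_measurable_continuous_onI continuous_on_charge_conj continuous_on_id)
  then show ?thesis
    using assms unfolding L2_def by (auto intro: measurable_compose)
qed

lemma L2_uminus: "f \<in> L2 \<nu> \<Longrightarrow> (\<lambda>x. - f x) \<in> L2 \<nu>"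
  by (simp add: L2_def)

lemma L2_converges_charge_conj:
  "L2_converges \<nu> w f \<Longrightarrow> L2_converges \<nu> (\<lambda>n x. charge_conj (w n x)) (\<lambda>x. charge_conj (f x))"
  by (simp add: L2_converges_def charge_conj_diff[symmetric])

lemma frechet_derivative_bounded_linear:
  assumes "bounded_linear T" "f differentiable (at x)"
  shows "frechet_derivative (\<lambda>x. T (f x)) (at x) = (\<lambda>v. T (frechet_derivative f (at x) v))"
  using bounded_linear.has_derivative[OF assms(1) frechet_derivative_works[THEN iffD1, OF assms(2)]]
  by (simp add: frechet_derivative_at[symmetric])

text \<open>Each directional derivative of the composite is \<open>T\<close> applied to that of
  \<open>f\<close>, so the induction must range over all \<open>f\<close>.\<close>

lemma Ck_bounded_linear:
  assumes T: "bounded_linear T"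
  shows "Ck k f UNIV \<Longrightarrow> Ck k (\<lambda>x. T (f x)) UNIV"
proof (induction k arbitrary: f)
  case 0
  then show ?case by (simp add: bounded_linear.continuous_on[OF T])
next
  case (Suc k)
  then have diff: "f differentiable (at x)" for x by simp
  have "(\<lambda>x. T (f x)) differentiable (at x)" for x
    by (rule differentiableI[OF bounded_linear.has_derivative[OF T
          frechet_derivative_works[THEN iffD1, OF diff]]])
  with Suc show ?case
    by (simp add: frechet_derivative_bounded_linear[OF T diff])
qed

text \<open>As \<open>T\<close> vanishes only at 0, the support is unchanged and stays
  compact.\<close>

lemma test_function_bounded_linear:
  assumes "bounded_linear T" "\<And>z. T z = 0 \<longleftrightarrow> z = 0" "test_function \<theta>"
  shows "test_function (\<lambda>x. T (\<theta> x))"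
  using assms by (simp add: test_function_def Ck_bounded_linear)

lemma test_function_cnj: "test_function \<theta> \<Longrightarrow> test_function (\<lambda>x. cnj (\<theta> x))"
  by (rule test_function_bounded_linear[OF bounded_linear_cnj]) simp_all

lemma test_function_differentiable: "test_function \<theta> \<Longrightarrow> \<theta> differentiable (at x)"
  unfolding test_function_def by (metis Ck.simps(2) UNIV_I)

lemma pderiv3_bounded_linear:
  assumes "bounded_linear T" "test_function \<theta>"
  shows "pderiv3 j (\<lambda>x. T (\<theta> x)) = (\<lambda>x. T (pderiv3 j \<theta> x))"
  by (rule ext) (simp add: pderiv3_def
      frechet_derivative_bounded_linear[OF assms(1) test_function_differentiable[OF assms(2)]])

section \<open>Distributions and the free operator\<close>

lemma dist_of_charge_conj:
  "dist_of \<nu> (\<lambda>x. charge_conj (f x)) \<theta> = charge_conj (dist_of \<nu> f (\<lambda>x. cnj (\<theta> x)))"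
  \<comment> \<open>Antilinearity conjugates the scalar factor, so the conjugation of a distribution
    also has to conjugate the test function.\<close>
  by (simp add: dist_of_def integral_charge_conj[symmetric] charge_conj_scale)

lemma dist_of_uminus: "dist_of \<nu> (\<lambda>x. - f x) \<theta> = - dist_of \<nu> f \<theta>"
proof -
  have "\<theta> x *s (- f x) = - (\<theta> x *s f x)" for x by (simp add: vec_eq_iff)
  then show ?thesis by (simp add: dist_of_def)
qed

lemma dist_pderiv_charge_conj:
  assumes "test_function \<theta>"
  shows "dist_pderiv j (dist_of \<nu> (\<lambda>x. charge_conj (f x))) \<theta>
         = charge_conj (dist_pderiv j (dist_of \<nu> f) (\<lambda>x. cnj (\<theta> x)))"
  by (simp add: dist_pderiv_def dist_of_charge_conj charge_conj_minus
      pderiv3_bounded_linear[OF bounded_linear_cnj assms])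

text \<open>The sign comes from conjugating \<open>- \<i>\<close> in the derivative term and from
  \<beta> in the mass term.\<close>

lemma dist_H_charge_conj:
  assumes "test_function \<theta>"
  shows "dist_H m (dist_of \<nu> (\<lambda>x. charge_conj (f x))) \<theta>
         = - charge_conj (dist_H m (dist_of \<nu> f) (\<lambda>x. cnj (\<theta> x)))"
proof -
  have "(\<Sum>j\<in>UNIV. dirac_alpha j *v dist_pderiv j (dist_of \<nu> (\<lambda>x. charge_conj (f x))) \<theta>)
        = charge_conj (\<Sum>j\<in>UNIV. dirac_alpha j *v dist_pderiv j (dist_of \<nu> f) (\<lambda>x. cnj (\<theta> x)))"
    by (simp add: dist_pderiv_charge_conj[OF assms] dirac_alpha_charge_conj charge_conj_sum)
  moreover have "dirac_beta *v dist_of \<nu> (\<lambda>x. charge_conj (f x)) \<theta>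
        = - charge_conj (dirac_beta *v dist_of \<nu> f (\<lambda>x. cnj (\<theta> x)))"
    by (simp add: dist_of_charge_conj dirac_beta_charge_conj)
  ultimately show ?thesis
    by (simp add: dist_H_def charge_conj_diff charge_conj_scaleR charge_conj_scale)
qed

section \<open>Traces, boundary operators and the shell operator\<close>

lemma is_trace_charge_conj:
  assumes "is_trace S u t"
  shows "is_trace S (\<lambda>x. charge_conj (u x)) (\<lambda>x. charge_conj (t x))"
proof -
  from assms obtain D w where
    u: "u \<in> L2 lborel" and t: "t \<in> L2 (surface_measure S)" and
    D: "\<And>j. D j \<in> L2 lborel" and
    weak: "\<And>j \<theta>. test_function \<theta> \<Longrightarrow>
      dist_pderiv j (dist_of lborel u) \<theta> = dist_of lborel (D j) \<theta>" and
    w: "\<And>n. test_function (w n)" and wu: "L2_converges lborel w u" and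
    wD: "\<And>j. L2_converges lborel (\<lambda>n. pderiv3 j (w n)) (D j)" and
    wt: "L2_converges (surface_measure S) w t"
    unfolding is_trace_def by blast
  \<comment> \<open>The same isometry carries the weak derivatives and the smooth approximants over,
    so all three L2 limits persist.\<close>
  define D' where "D' = (\<lambda>j x. charge_conj (D j x))"
  define w' where "w' = (\<lambda>n x. charge_conj (w n x))"
  have "D' j \<in> L2 lborel" for j
    using D L2_charge_conj unfolding D'_def by blast
  moreover have "dist_pderiv j (dist_of lborel (\<lambda>x. charge_conj (u x))) \<theta> = dist_of lborel (D' j) \<theta>"
    if "test_function \<theta>" for j \<theta>
    using weak[OF test_function_cnj[OF that]]
    by (simp add: D'_def dist_pderiv_charge_conj[OF that] dist_of_charge_conj)
  moreover have "test_function (w' n)" for n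
    unfolding w'_def by (rule test_function_bounded_linear[OF bounded_linear_charge_conj _ w]) simp
  moreover have "L2_converges lborel w' (\<lambda>x. charge_conj (u x))"
    unfolding w'_def by (rule L2_converges_charge_conj[OF wu])
  moreover have "L2_converges lborel (\<lambda>n. pderiv3 j (w' n)) (D' j)" for j
    using L2_converges_charge_conj[OF wD]
    by (simp add: w'_def D'_def pderiv3_bounded_linear[OF bounded_linear_charge_conj w])
  moreover have "L2_converges (surface_measure S) w' (\<lambda>x. charge_conj (t x))"
    unfolding w'_def by (rule L2_converges_charge_conj[OF wt])
  ultimately show ?thesis
    unfolding is_trace_def using u t L2_charge_conj by blast
qed

text \<open>The truncation is a real indicator, so it passes through the conjugation; continuity
  then carries the principal value over.\<close>

lemma is_C_sigma_charge_conj: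
  assumes "is_C_sigma m S g c"
  shows "is_C_sigma m S (\<lambda>x. - charge_conj (g x)) (\<lambda>x. charge_conj (c x))"
  using assms L2_charge_conj
  by (auto simp: is_C_sigma_def set_lebesgue_integral_def phi_neg_charge_conj
      charge_conj_scaleR[symmetric] integral_charge_conj
      intro: tendsto_charge_conj elim!: eventually_mono)

lemma is_C_side_charge_conj:
  assumes "is_C_side m S W g c"
  shows "is_C_side m S W (\<lambda>x. - charge_conj (g x)) (\<lambda>x. charge_conj (c x))"
  using assms L2_charge_conj
  by (auto simp: is_C_side_def conv_phi_charge_conj[abs_def]
      intro: tendsto_charge_conj elim!: eventually_mono)

text \<open>The conjugation maps the graph for \<open>lam\<close> into the graph for
  \<open>- lam\<close>, reversing the sign of the image.\<close>

lemma dirac_shell_charge_conj: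
  assumes "dirac_shell m lam \<Omega> \<phi> F"
  shows "dirac_shell m (- lam) \<Omega> (\<lambda>x. charge_conj (\<phi> x)) (\<lambda>x. - charge_conj (F x))"
proof -
  let ?\<sigma> = "surface_measure (frontier \<Omega>)"
  from assms obtain G g t c cp cm where
    L2: "\<phi> \<in> L2 lborel" "F \<in> L2 lborel" "G \<in> L2 lborel" "g \<in> L2 ?\<sigma>" and
    \<phi>: "AE x in lborel. \<phi> x = conv_phi m lborel G x + conv_phi m ?\<sigma> g x" and
    trace: "is_trace (frontier \<Omega>) (conv_phi m lborel G) t" and
    c: "is_C_sigma m (frontier \<Omega>) g c" and
    tc: "AE x in ?\<sigma>. t x = - ((1 / lam) *\<^sub>R g x + c x)" and
    cp: "is_C_side m (frontier \<Omega>) \<Omega> g cp" and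
    cm: "is_C_side m (frontier \<Omega>) (- closure \<Omega>) g cm" and
    T: "\<And>\<theta>. test_function \<theta> \<Longrightarrow> dist_H m (dist_of lborel \<phi>) \<theta>
          + dist_of ?\<sigma> (\<lambda>x. (lam / 2) *\<^sub>R ((t x + cp x) + (t x + cm x))) \<theta> = dist_of lborel F \<theta>"
    unfolding dirac_shell_def Let_def by blast
  \<comment> \<open>Only the densities are negated; the potentials and boundary values they generate
    are conjugated without a sign.\<close>
  define G' where "G' = (\<lambda>x. - charge_conj (G x))"
  define g' where "g' = (\<lambda>x. - charge_conj (g x))"
  define t' where "t' = (\<lambda>x. charge_conj (t x))"
  define c' where "c' = (\<lambda>x. charge_conj (c x))"
  define cp' where "cp' = (\<lambda>x. charge_conj (cp x))"
  define cm' where "cm' = (\<lambda>x. charge_conj (cm x))"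
  have "(\<lambda>x. charge_conj (\<phi> x)) \<in> L2 lborel" "(\<lambda>x. - charge_conj (F x)) \<in> L2 lborel"
    "G' \<in> L2 lborel" "g' \<in> L2 ?\<sigma>"
    using L2 L2_charge_conj L2_uminus unfolding G'_def g'_def by blast+
  moreover have "AE x in lborel. charge_conj (\<phi> x) = conv_phi m lborel G' x + conv_phi m ?\<sigma> g' x"
    using \<phi> by eventually_elim (simp add: G'_def g'_def conv_phi_charge_conj charge_conj_add)
  moreover have "is_trace (frontier \<Omega>) (conv_phi m lborel G') t'"
    using is_trace_charge_conj[OF trace] by (simp add: G'_def t'_def conv_phi_charge_conj[abs_def])
  moreover have "is_C_sigma m (frontier \<Omega>) g' c'"
    unfolding g'_def c'_def by (rule is_C_sigma_charge_conj[OF c])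
  \<comment> \<open>This relative sign between \<open>g'\<close> and \<open>t'\<close>,
    \<open>c'\<close> is what turns \<open>lam\<close> into \<open>- lam\<close> in the boundary
    condition.\<close>
  moreover have "AE x in ?\<sigma>. t' x = - ((1 / (- lam)) *\<^sub>R g' x + c' x)"
    using tc by eventually_elim
      (simp add: t'_def g'_def c'_def charge_conj_minus charge_conj_add charge_conj_diff charge_conj_scaleR)
  moreover have "is_C_side m (frontier \<Omega>) \<Omega> g' cp'"
    unfolding g'_def cp'_def by (rule is_C_side_charge_conj[OF cp])
  moreover have "is_C_side m (frontier \<Omega>) (- closure \<Omega>) g' cm'"
    unfolding g'_def cm'_def by (rule is_C_side_charge_conj[OF cm])
  moreover have "dist_H m (dist_of lborel (\<lambda>x. charge_conj (\<phi> x))) \<theta>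
        + dist_of ?\<sigma> (\<lambda>x. (- lam / 2) *\<^sub>R ((t' x + cp' x) + (t' x + cm' x))) \<theta>
        = dist_of lborel (\<lambda>x. - charge_conj (F x)) \<theta>" if \<theta>: "test_function \<theta>" for \<theta>
  proof -
    have "(\<lambda>x. (- lam / 2) *\<^sub>R ((t' x + cp' x) + (t' x + cm' x)))
        = (\<lambda>x. - charge_conj ((lam / 2) *\<^sub>R ((t x + cp x) + (t x + cm x))))"
      by (simp only: t'_def cp'_def cm'_def charge_conj_scaleR charge_conj_add
          minus_divide_left[symmetric] scaleR_minus_left)
    \<comment> \<open>The hypothesis is tested against the conjugate of \<theta>, then conjugated
      and negated: the free part supplies its own minus sign, the shell term gets it from the
      reversed coupling.\<close>
    then show ?thesis
      using T[OF test_function_cnj[OF \<theta>], symmetric]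
      by (simp add: dist_of_uminus dist_of_charge_conj dist_H_charge_conj[OF \<theta>] charge_conj_add)
  qed
  ultimately show ?thesis
    unfolding dirac_shell_def Let_def by blast
qed

theorem theorem3p6:
  fixes m lam a :: real and \<Omega> :: "(real^3) set"
  assumes "m > 0"
    and "bounded_C2_domain \<Omega>"
    and "surface_measure (frontier \<Omega>) = distr (surface_measure (frontier \<Omega>)) borel uminus"
    and "lam \<noteq> 0"
    and "- m < a" and "a < m"
    and "is_eigenvalue (dirac_shell m lam \<Omega>) a"
  shows "is_eigenvalue (dirac_shell m (- lam) \<Omega>) (- a)"
proof -
  from assms(7) obtain \<phi> where nz: "\<not> (AE x in lborel. \<phi> x = 0)"
    and ev: "dirac_shell m lam \<Omega> \<phi> (\<lambda>x. a *\<^sub>R \<phi> x)"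
    unfolding is_eigenvalue_def by blast
  \<comment> \<open>Because \<open>a\<close> is real, it passes through the conjugation unchanged,
    and the sign on the image becomes the sign of the eigenvalue.\<close>
  have "dirac_shell m (- lam) \<Omega> (\<lambda>x. charge_conj (\<phi> x)) (\<lambda>x. - a *\<^sub>R charge_conj (\<phi> x))"
    using dirac_shell_charge_conj[OF ev] by (simp add: charge_conj_scaleR)
  moreover have "\<not> (AE x in lborel. charge_conj (\<phi> x) = 0)"
    using nz by simp
  ultimately show ?thesis
    unfolding is_eigenvalue_def by (intro exI[of _ "\<lambda>x. charge_conj (\<phi> x)"] conjI)
qed

end
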